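(* Let $\Gamma$ be a directed graph and $I(\Gamma)$ its graph inverse semigroup. For a vertex $v$ of $\Gamma$, the local submonoid $vI(\Gamma)v$ is trivial, i.e. $vI(\Gamma)v=\{0,v\}$, if and only if $v$ is a sink.
   Context: A directed graph $\Gamma$ consists of a non-empty set $\Gamma^0$ of vertices, a possibly empty set $\Gamma^1$ of edges, and source and range maps $s,r:\Gamma^1\to\Gamma^0$. For each edge $e$ there is an inverse (ghost) edge $e^*$ with $s(e^* )=r(e)$ and $r(e^* )=s(e)$; $(\Gamma^1)^*$ is the set of ghost edges. For a vertex $v$, put $s(v)=r(v)=v$. A vertex $v$ is a sink if its outdegree $|s^{-1}(v)|$ is zero, where $s^{-1}(v)\subseteq\Gamma^1$, i.e. no edge starts at $v$. The graph inverse semigroup $I(\Gamma)$ is the semigroup with zero $0$ generated by $\Gamma^0\cup\Gamma^1\cup(\Gamma^1)^*$ subject to the relations: (1) $s(e)e=e=e\,r(e)$ for all $e\in\Gamma^0\cup\Gamma^1\cup(\Gamma^1)^*$; (2) $uv=u$ if $u=v$ and $uv=0$ if $u\neq v$, for all $u,v\in\Gamma^0$; (3) $e^*f=r(e)$ if $e=f$ and $e^*f=0$ if $e\ne f$, for all $e,f\in\Gamma^1$. The zero element is always included in $I(\Gamma)$. Each vertex $v$ is an idempotent of $I(\Gamma)$, and the local submonoid at $v$ is $vI(\Gamma)v=\{vxv : x\in I(\Gamma)\}$. It is called trivial when it equals $\{0,v\}$. *)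

theory Defs
  imports "Graph_Theory.Digraph"
begin

text \<open>
  Generators of the graph inverse semigroup: the vertices, the edges (the arcs of the
  digraph) and one ghost edge \<open>Ghost e\<close> for every arc \<open>e\<close>.
\<close>

datatype ('a, 'b) gis_gen = Vertex 'a | Edge 'b | Ghost 'b

definition gis_gens :: "('a, 'b) pre_digraph \<Rightarrow> ('a, 'b) gis_gen set" where
  "gis_gens G = Vertex ` verts G \<union> Edge ` arcs G \<union> Ghost ` arcs G"

fun gis_src :: "('a, 'b) pre_digraph \<Rightarrow> ('a, 'b) gis_gen \<Rightarrow> 'a" where
  "gis_src G (Vertex v) = v"
| "gis_src G (Edge e) = tail G e"
| "gis_src G (Ghost e) = head G e"

fun gis_rng :: "('a, 'b) pre_digraph \<Rightarrow> ('a, 'b) gis_gen \<Rightarrow> 'a" where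
  "gis_rng G (Vertex v) = v"
| "gis_rng G (Edge e) = head G e"
| "gis_rng G (Ghost e) = tail G e"

text \<open>
  The free semigroup with zero on the generators: nonempty words together with an adjoined
  absorbing element. The empty word is excluded, since no identity is adjoined.
\<close>

datatype ('a, 'b) gis_word = Zero | Word "('a, 'b) gis_gen list"

definition gis_words :: "('a, 'b) pre_digraph \<Rightarrow> ('a, 'b) gis_word set" where
  "gis_words G = insert Zero (Word ` {w. w \<noteq> [] \<and> set w \<subseteq> gis_gens G})"

fun word_mult :: "('a, 'b) gis_word \<Rightarrow> ('a, 'b) gis_word \<Rightarrow> ('a, 'b) gis_word" where
  "word_mult (Word u) (Word w) = Word (u @ w)"
| "word_mult _ _ = Zero"

inductive_set gis_rels ::
    "('a, 'b) pre_digraph \<Rightarrow> (('a, 'b) gis_word \<times> ('a, 'b) gis_word) set"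
  for G :: "('a, 'b) pre_digraph" where
  src: "x \<in> gis_gens G \<Longrightarrow> (Word [Vertex (gis_src G x), x], Word [x]) \<in> gis_rels G"
| rng: "x \<in> gis_gens G \<Longrightarrow> (Word [x, Vertex (gis_rng G x)], Word [x]) \<in> gis_rels G"
| vertex_eq: "u \<in> verts G \<Longrightarrow> (Word [Vertex u, Vertex u], Word [Vertex u]) \<in> gis_rels G"
| vertex_neq: "\<lbrakk>u \<in> verts G; v \<in> verts G; u \<noteq> v\<rbrakk>
    \<Longrightarrow> (Word [Vertex u, Vertex v], Zero) \<in> gis_rels G"
| ghost_eq: "e \<in> arcs G \<Longrightarrow> (Word [Ghost e, Edge e], Word [Vertex (head G e)]) \<in> gis_rels G"
| ghost_neq: "\<lbrakk>e \<in> arcs G; f \<in> arcs G; e \<noteq> f\<rbrakk>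
    \<Longrightarrow> (Word [Ghost e, Edge f], Zero) \<in> gis_rels G"

text \<open>The least congruence on the free semigroup with zero that contains the relations.\<close>

inductive_set gis_cong ::
    "('a, 'b) pre_digraph \<Rightarrow> (('a, 'b) gis_word \<times> ('a, 'b) gis_word) set"
  for G :: "('a, 'b) pre_digraph" where
  rel: "(x, y) \<in> gis_rels G \<Longrightarrow> (x, y) \<in> gis_cong G"
| refl: "x \<in> gis_words G \<Longrightarrow> (x, x) \<in> gis_cong G"
| sym: "(x, y) \<in> gis_cong G \<Longrightarrow> (y, x) \<in> gis_cong G"
| trans: "\<lbrakk>(x, y) \<in> gis_cong G; (y, z) \<in> gis_cong G\<rbrakk> \<Longrightarrow> (x, z) \<in> gis_cong G"
| mult: "\<lbrakk>(x, x') \<in> gis_cong G; (y, y') \<in> gis_cong G\<rbrakk>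
    \<Longrightarrow> (word_mult x y, word_mult x' y') \<in> gis_cong G"

definition graph_inverse_semigroup :: "('a, 'b) pre_digraph \<Rightarrow> ('a, 'b) gis_word set set" where
  "graph_inverse_semigroup G = gis_words G // gis_cong G"

definition gis_class :: "('a, 'b) pre_digraph \<Rightarrow> ('a, 'b) gis_word \<Rightarrow> ('a, 'b) gis_word set" where
  "gis_class G x = gis_cong G `` {x}"

text \<open>
  On congruence classes the following union is the class of a product of representatives;
  see \<open>gis_mult_class\<close> below.
\<close>

definition gis_mult :: "('a, 'b) pre_digraph \<Rightarrow> ('a, 'b) gis_word set \<Rightarrow>
    ('a, 'b) gis_word set \<Rightarrow> ('a, 'b) gis_word set" where
  "gis_mult G A B = (\<Union>x\<in>A. \<Union>y\<in>B. gis_class G (word_mult x y))"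

definition gis_zero :: "('a, 'b) pre_digraph \<Rightarrow> ('a, 'b) gis_word set" where
  "gis_zero G = gis_class G Zero"

definition gis_vertex :: "('a, 'b) pre_digraph \<Rightarrow> 'a \<Rightarrow> ('a, 'b) gis_word set" where
  "gis_vertex G v = gis_class G (Word [Vertex v])"

definition local_submonoid :: "('a, 'b) pre_digraph \<Rightarrow> 'a \<Rightarrow> ('a, 'b) gis_word set set" where
  "local_submonoid G v =
    {gis_mult G (gis_mult G (gis_vertex G v) x) (gis_vertex G v) | x.
      x \<in> graph_inverse_semigroup G}"

text \<open>
  A sink is defined by emptiness of the set of outgoing arcs and not by \<open>out_degree G v = 0\<close>,
  because the cardinality of an infinite set is 0 in HOL and vertices may emit infinitely
  many edges.
\<close>

definition is_sink :: "('a, 'b) pre_digraph \<Rightarrow> 'a \<Rightarrow> bool" where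
  "is_sink G v \<longleftrightarrow> v \<in> verts G \<and> out_arcs G v = {}"

lemma word_mult_assoc: "word_mult (word_mult x y) z = word_mult x (word_mult y z)"
  by (cases x; cases y; cases z) auto

lemma word_mult_closed:
  "\<lbrakk>x \<in> gis_words G; y \<in> gis_words G\<rbrakk> \<Longrightarrow> word_mult x y \<in> gis_words G"
  by (cases x; cases y) (auto simp: gis_words_def)

lemma vertex_word: "v \<in> verts G \<Longrightarrow> Word [Vertex v] \<in> gis_words G"
  by (auto simp: gis_words_def gis_gens_def)

context wf_digraph
begin

lemma gis_src_in_verts: "x \<in> gis_gens G \<Longrightarrow> gis_src G x \<in> verts G"
  by (auto simp: gis_gens_def)

lemma gis_rng_in_verts: "x \<in> gis_gens G \<Longrightarrow> gis_rng G x \<in> verts G"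
  by (auto simp: gis_gens_def)

lemma gis_rels_in_words: "(x, y) \<in> gis_rels G \<Longrightarrow> x \<in> gis_words G \<and> y \<in> gis_words G"
  by (induction rule: gis_rels.induct)
    (auto simp: gis_words_def gis_gens_def)

lemma gis_cong_in_words: "(x, y) \<in> gis_cong G \<Longrightarrow> x \<in> gis_words G \<and> y \<in> gis_words G"
  by (induction rule: gis_cong.induct) (auto dest: gis_rels_in_words intro: word_mult_closed)

lemma equiv_gis_cong: "equiv (gis_words G) (gis_cong G)"
proof (rule equivI)
  show "gis_cong G \<subseteq> gis_words G \<times> gis_words G"
    using gis_cong_in_words by auto
  show "refl_on (gis_words G) (gis_cong G)"
    by (auto simp: refl_on_def intro: gis_cong.refl)
  show "sym (gis_cong G)"
    by (auto intro: symI gis_cong.sym)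
  show "trans (gis_cong G)"
    by (auto intro: transI gis_cong.trans)
qed

lemma gis_class_eq_iff:
  "\<lbrakk>x \<in> gis_words G; y \<in> gis_words G\<rbrakk>
    \<Longrightarrow> gis_class G x = gis_class G y \<longleftrightarrow> (x, y) \<in> gis_cong G"
  unfolding gis_class_def by (rule eq_equiv_class_iff[OF equiv_gis_cong])

lemma gis_mult_class:
  assumes "x \<in> gis_words G" "y \<in> gis_words G"
  shows "gis_mult G (gis_class G x) (gis_class G y) = gis_class G (word_mult x y)"
proof -
  have "gis_class G (word_mult x' y') = gis_class G (word_mult x y)"
    if "x' \<in> gis_class G x" "y' \<in> gis_class G y" for x' y'
  proof -
    have "(word_mult x y, word_mult x' y') \<in> gis_cong G"
      using that by (auto simp: gis_class_def intro: gis_cong.mult)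
    then show ?thesis
      unfolding gis_class_def by (metis equiv_class_eq equiv_gis_cong)
  qed
  moreover have "x \<in> gis_class G x" "y \<in> gis_class G y"
    using assms by (auto simp: gis_class_def intro: gis_cong.refl)
  ultimately show ?thesis
    unfolding gis_mult_def by blast
qed

lemma gis_mult_assoc:
  assumes "A \<in> graph_inverse_semigroup G" "B \<in> graph_inverse_semigroup G"
    "C \<in> graph_inverse_semigroup G"
  shows "gis_mult G (gis_mult G A B) C = gis_mult G A (gis_mult G B C)"
proof -
  obtain x y z where "x \<in> gis_words G" "y \<in> gis_words G" "z \<in> gis_words G"
    "A = gis_class G x" "B = gis_class G y" "C = gis_class G z"
    using assms unfolding graph_inverse_semigroup_def gis_class_def by (auto elim!: quotientE)
  then show ?thesis
    by (simp add: gis_mult_class word_mult_closed word_mult_assoc)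
qed

lemma gis_vertex_idem:
  assumes "v \<in> verts G"
  shows "gis_mult G (gis_vertex G v) (gis_vertex G v) = gis_vertex G v"
proof -
  have "(Word [Vertex v, Vertex v], Word [Vertex v]) \<in> gis_cong G"
    using assms by (intro gis_cong.rel gis_rels.vertex_eq)
  then show ?thesis
    using assms gis_cong_in_words
    by (auto simp: gis_vertex_def gis_mult_class vertex_word gis_class_eq_iff)
qed

end

end

theory Submission
  imports Defs
begin

text \<open>
  If \<open>v\<close> is a sink, reduce a product \<open>w v\<close> from its right end. Read leftwards, a generator that
  meets an edge path ending in \<open>v\<close> kills it, shortens it, lengthens it or leaves it alone; only a
  ghost edge meeting the empty path at \<open>v\<close> could leave this shape, and that product is \<open>0\<close>
  because ghost edges ranging in \<open>v\<close> come from edges starting at \<open>v\<close>. So \<open>w v\<close> is \<open>0\<close> or an edge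
  path ending in \<open>v\<close> (\<open>word_times_sink\<close>). Multiplying by \<open>v\<close> on the left then kills every
  nonempty path, as no edge starts at \<open>v\<close>, so only \<open>0\<close> and \<open>v\<close> remain.

  If some edge \<open>e\<close> starts at \<open>v\<close>, the product of \<open>e\<close> and its ghost lies in the local submonoid at
  \<open>v\<close>. To see that it is neither \<open>0\<close> nor \<open>v\<close>, let the semigroup act on paths by partial maps:
  edges are prepended, ghost edges delete the first edge, and vertices restrict to the
  paths that start there. The defining relations hold for these maps (\<open>gis_cong_act\<close>).
  The product of \<open>e\<close> and its ghost is defined at the path \<open>e\<close>, where \<open>0\<close> is undefined, and is
  undefined at the empty path at \<open>v\<close>, where \<open>v\<close> is defined.
\<close>

section \<open>Reduction of words at a sink\<close>

lemma Word_in_gis_words [simp]: "Word w \<in> gis_words G \<longleftrightarrow> w \<noteq> [] \<and> set w \<subseteq> gis_gens G"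
  by (auto simp: gis_words_def)

lemma Zero_in_gis_words [simp]: "Zero \<in> gis_words G"
  by (simp add: gis_words_def)

lemma word_mult_Zero_right [simp]: "word_mult x Zero = Zero"
  by (cases x) auto

lemma gis_cong_append:
  assumes "(Word u, y) \<in> gis_cong G" "Word t \<in> gis_words G"
  shows "(Word (u @ t), word_mult y (Word t)) \<in> gis_cong G"
  using gis_cong.mult[OF assms(1) gis_cong.refl[OF assms(2)]] by simp

lemma gis_cong_prepend:
  assumes "Word t \<in> gis_words G" "(Word u, y) \<in> gis_cong G"
  shows "(Word (t @ u), word_mult (Word t) y) \<in> gis_cong G"
  using gis_cong.mult[OF gis_cong.refl[OF assms(1)] assms(2)] by simp

context wf_digraph
begin

lemma vertex_times_gen:
  assumes u: "u \<in> verts G" and x: "x \<in> gis_gens G"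
  shows "(Word [Vertex u, x], if u = gis_src G x then Word [x] else Zero) \<in> gis_cong G"
proof (cases "u = gis_src G x")
  case True
  then show ?thesis using x by (auto intro: gis_cong.rel gis_rels.src)
next
  case False
  let ?s = "Vertex (gis_src G x)"
  have ug: "Vertex u \<in> gis_gens G" using u by (simp add: gis_gens_def)
  \<comment> \<open>Insert the source of \<open>x\<close>, which is orthogonal to \<open>u\<close>.\<close>
  have "(Word [Vertex u, x], Word [Vertex u, ?s, x]) \<in> gis_cong G"
    using gis_cong_prepend[OF _ gis_cong.rel[OF gis_rels.src[OF x]], of "[Vertex u]"] ug
    by (auto intro: gis_cong.sym)
  moreover have "(Word [Vertex u, ?s, x], Zero) \<in> gis_cong G"
    using gis_cong_append[OF gis_cong.rel[OF gis_rels.vertex_neq[OF u gis_src_in_verts[OF x] False]],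
        of "[x]"] x by simp
  ultimately show ?thesis using False by (auto intro: gis_cong.trans)
qed

lemma gen_times_vertex_zero:
  assumes u: "u \<in> verts G" and x: "x \<in> gis_gens G" and ne: "gis_rng G x \<noteq> u"
  shows "(Word [x, Vertex u], Zero) \<in> gis_cong G"
proof -
  let ?r = "Vertex (gis_rng G x)"
  have ug: "Vertex u \<in> gis_gens G" using u by (simp add: gis_gens_def)
  have "(Word [x, Vertex u], Word [x, ?r, Vertex u]) \<in> gis_cong G"
    using gis_cong_append[OF gis_cong.rel[OF gis_rels.rng[OF x]], of "[Vertex u]"] ug
    by (auto intro: gis_cong.sym)
  moreover have "(Word [x, ?r, Vertex u], Zero) \<in> gis_cong G"
    using gis_cong_prepend[OF _ gis_cong.rel[OF gis_rels.vertex_neq[OF gis_rng_in_verts[OF x] u ne]],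
        of "[x]"] x by simp
  ultimately show ?thesis by (rule gis_cong.trans)
qed

lemma vertex_times_word:
  assumes u: "u \<in> verts G" and w: "x # t \<in> lists (gis_gens G)"
  shows "(Word (Vertex u # x # t), if u = gis_src G x then Word (x # t) else Zero) \<in> gis_cong G"
proof (cases t)
  case Nil
  then show ?thesis using vertex_times_gen[OF u, of x] w by (auto split: if_splits)
next
  case (Cons y t')
  then have "Word t \<in> gis_words G" using w by auto
  from gis_cong_append[OF vertex_times_gen[OF u, of x] this] w
  show ?thesis by (auto split: if_splits)
qed

lemma vertex_times_path:
  assumes "u \<in> verts G" "v \<in> verts G" "set p \<subseteq> arcs G"
  shows "(Word (Vertex u # map Edge p @ [Vertex v]), Zero) \<in> gis_cong G \<or>
    (Word (Vertex u # map Edge p @ [Vertex v]), Word (map Edge p @ [Vertex v])) \<in> gis_cong G"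
proof -
  obtain x t where xt: "map Edge p @ [Vertex v] = x # t"
    by (cases "map Edge p @ [Vertex v]") auto
  have "set (map Edge p @ [Vertex v]) \<subseteq> gis_gens G"
    using assms by (auto simp: gis_gens_def)
  then have "x # t \<in> lists (gis_gens G)" unfolding xt by auto
  from vertex_times_word[OF assms(1) this] show ?thesis
    unfolding xt by (auto split: if_splits)
qed

text \<open>
  Edge paths ending in \<open>v\<close> are stable, up to \<open>Zero\<close>, under left multiplication by a generator.
  Here \<open>p\<close> is an arbitrary sequence of arcs: one that is not composable gives a word congruent
  to \<open>Zero\<close>, so admitting it does not change the meaning and makes the edge case immediate.
\<close>

lemma word_times_sink:
  assumes sink: "is_sink G v" and "set w \<subseteq> gis_gens G"
  shows "(Word (w @ [Vertex v]), Zero) \<in> gis_cong G \<or>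
    (\<exists>p. set p \<subseteq> arcs G \<and> (Word (w @ [Vertex v]), Word (map Edge p @ [Vertex v])) \<in> gis_cong G)"
  using assms(2)
proof (induction w)
  case Nil
  have "(Word [Vertex v], Word (map Edge [] @ [Vertex v])) \<in> gis_cong G"
    using sink by (auto intro!: gis_cong.refl simp: is_sink_def gis_gens_def)
  then show ?case by (intro disjI2 exI[of _ "[]"]) auto
next
  case (Cons x w)
  have v: "v \<in> verts G" using sink by (simp add: is_sink_def)
  have x: "x \<in> gis_gens G" using Cons.prems by simp
  then have xw: "Word [x] \<in> gis_words G" by simp
  have "(Word (x # w @ [Vertex v]), Zero) \<in> gis_cong G \<or>
    (\<exists>p. set p \<subseteq> arcs G \<and>
      (Word (x # w @ [Vertex v]), Word (x # map Edge p @ [Vertex v])) \<in> gis_cong G)"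
    using Cons.IH Cons.prems gis_cong_prepend[OF xw] by fastforce
  then show ?case
  proof (elim disjE exE conjE)
    assume "(Word (x # w @ [Vertex v]), Zero) \<in> gis_cong G"
    then show ?thesis by simp
  next
    fix p
    assume p: "set p \<subseteq> arcs G"
      and red: "(Word (x # w @ [Vertex v]), Word (x # map Edge p @ [Vertex v])) \<in> gis_cong G"
    have "(Word (x # map Edge p @ [Vertex v]), Zero) \<in> gis_cong G \<or>
      (\<exists>q. set q \<subseteq> arcs G \<and>
        (Word (x # map Edge p @ [Vertex v]), Word (map Edge q @ [Vertex v])) \<in> gis_cong G)"
    proof (cases x)
      case (Vertex u)
      then have "u \<in> verts G" using x by (auto simp: gis_gens_def)
      from vertex_times_path[OF this v p] show ?thesis using p Vertex by auto
    next
      case (Edge e)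
      have "set (x # map Edge p @ [Vertex v]) \<subseteq> gis_gens G"
        using p v x by (auto simp: gis_gens_def)
      then have "(Word (x # map Edge p @ [Vertex v]), Word (map Edge (e # p) @ [Vertex v]))
          \<in> gis_cong G"
        using Edge by (auto intro!: gis_cong.refl)
      moreover have "set (e # p) \<subseteq> arcs G" using p x Edge by (auto simp: gis_gens_def)
      ultimately show ?thesis by blast
    next
      case (Ghost e)
      then have e: "e \<in> arcs G" using x by (auto simp: gis_gens_def)
      show ?thesis
      proof (cases p)
        case Nil
        \<comment> \<open>The only step where sinkness matters: the edge \<open>e\<close> does not start at \<open>v\<close>.\<close>
        have "gis_rng G x \<noteq> v" using sink e Ghost by (auto simp: is_sink_def)
        from gen_times_vertex_zero[OF v x this] Nil show ?thesis by simp
      next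
        case (Cons f q)
        then have f: "f \<in> arcs G" and q: "set q \<subseteq> arcs G" using p by auto
        have t: "Word (map Edge q @ [Vertex v]) \<in> gis_words G"
          using q v by (auto simp: gis_gens_def)
        show ?thesis
        proof (cases "e = f")
          case True
          have "(Word (x # map Edge p @ [Vertex v]),
              Word (Vertex (head G e) # map Edge q @ [Vertex v])) \<in> gis_cong G"
            using gis_cong_append[OF gis_cong.rel[OF gis_rels.ghost_eq[OF e]] t] Cons Ghost True
            by simp
          moreover have "head G e \<in> verts G" using e by simp
          ultimately show ?thesis
            using vertex_times_path[OF _ v q] q gis_cong.trans by blast
        next
          case False
          then show ?thesis
            using gis_cong_append[OF gis_cong.rel[OF gis_rels.ghost_neq[OF e f]] t] Cons Ghost
            by simp
        qed
      qed
    qed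
    then show ?thesis using gis_cong.trans[OF red] by auto
  qed
qed

lemma sink_corner_word:
  assumes sink: "is_sink G v" and w: "set w \<subseteq> gis_gens G"
  shows "(Word (Vertex v # w @ [Vertex v]), Zero) \<in> gis_cong G \<or>
    (Word (Vertex v # w @ [Vertex v]), Word [Vertex v]) \<in> gis_cong G"
proof -
  have v: "v \<in> verts G" using sink by (simp add: is_sink_def)
  then have vw: "Word [Vertex v] \<in> gis_words G" by (rule vertex_word)
  from word_times_sink[OF sink w] show ?thesis
  proof (elim disjE exE conjE)
    assume "(Word (w @ [Vertex v]), Zero) \<in> gis_cong G"
    from gis_cong_prepend[OF vw this] show ?thesis by simp
  next
    fix p
    assume p: "set p \<subseteq> arcs G"
      and red: "(Word (w @ [Vertex v]), Word (map Edge p @ [Vertex v])) \<in> gis_cong G"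
    have red': "(Word (Vertex v # w @ [Vertex v]), Word (Vertex v # map Edge p @ [Vertex v]))
        \<in> gis_cong G"
      using gis_cong_prepend[OF vw red] by simp
    show ?thesis
    proof (cases p)
      case Nil
      then show ?thesis
        using gis_cong.trans[OF red'] gis_cong.rel[OF gis_rels.vertex_eq[OF v]] by simp
    next
      case (Cons e q)
      have "v \<noteq> gis_src G (Edge e :: ('a, 'b) gis_gen)"
        using sink p Cons by (auto simp: is_sink_def)
      moreover have "set (map Edge p @ [Vertex v]) \<subseteq> gis_gens G"
        using p v by (auto simp: gis_gens_def)
      then have "Edge e # map Edge q @ [Vertex v] \<in> lists (gis_gens G)" using Cons by auto
      ultimately have "(Word (Vertex v # map Edge p @ [Vertex v]), Zero) \<in> gis_cong G"
        using vertex_times_word[OF v] Cons by fastforce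
      then show ?thesis using gis_cong.trans[OF red'] by blast
    qed
  qed
qed

end

section \<open>A partial action on paths\<close>

text \<open>
  A path is a list of edges together with its final vertex, so that the empty paths at
  different vertices are distinct. Arbitrary lists are admitted, since edges and ghost edges
  act through the starting vertex and the first edge alone.
\<close>

fun path_start :: "('a, 'b) pre_digraph \<Rightarrow> 'b list \<times> 'a \<Rightarrow> 'a" where
  "path_start G ([], u) = u"
| "path_start G (e # p, u) = tail G e"

fun gen_act :: "('a, 'b) pre_digraph \<Rightarrow> ('a, 'b) gis_gen \<Rightarrow> 'b list \<times> 'a \<Rightarrow> ('b list \<times> 'a) option"
  where
  "gen_act G (Vertex v) s = (if path_start G s = v then Some s else None)"
| "gen_act G (Edge e) (p, u) = (if path_start G (p, u) = head G e then Some (e # p, u) else None)"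
| "gen_act G (Ghost e) ([], u) = None"
| "gen_act G (Ghost e) (f # p, u) =
    (if e = f \<and> path_start G (p, u) = head G e then Some (p, u) else None)"

fun word_act :: "('a, 'b) pre_digraph \<Rightarrow> ('a, 'b) gis_word \<Rightarrow> 'b list \<times> 'a \<Rightarrow> ('b list \<times> 'a) option"
  where
  "word_act G Zero s = None"
| "word_act G (Word w) s = foldr (\<lambda>x t. Option.bind t (gen_act G x)) w (Some s)"

lemma foldr_bind_None [simp]: "foldr (\<lambda>x t. Option.bind t (g x)) w None = None"
  by (induction w) auto

lemma word_act_mult: "word_act G (word_mult x y) s = Option.bind (word_act G y s) (word_act G x)"
proof (cases x)
  case Zero
  then show ?thesis by (cases "word_act G y s") auto
next
  case (Word w)
  show ?thesis
  proof (cases y)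
    case (Word w')
    with \<open>x = Word w\<close> show ?thesis by (cases "word_act G y s") auto
  qed simp
qed

lemma gis_rels_act: "(x, y) \<in> gis_rels G \<Longrightarrow> word_act G x s = word_act G y s"
proof (induction rule: gis_rels.induct)
  case (src x)
  show ?case by (cases "(G, x, s)" rule: gen_act.cases) auto
next
  case (rng x)
  show ?case by (cases "(G, x, s)" rule: gen_act.cases) auto
qed (cases s; auto)+

text \<open>
  The action descends to the quotient; distinct partial maps thus certify distinct elements.
\<close>

lemma gis_cong_act: "(x, y) \<in> gis_cong G \<Longrightarrow> word_act G x = word_act G y"
proof (induction rule: gis_cong.induct)
  case (mult x x' y y')
  show ?case by (rule ext) (simp only: word_act_mult mult.IH)
qed (auto simp: gis_rels_act)

section \<open>Local submonoids\<close>

context wf_digraph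
begin

lemma local_submonoid_eq:
  assumes "v \<in> verts G"
  shows "local_submonoid G v =
    (\<lambda>w. gis_class G (word_mult (word_mult (Word [Vertex v]) w) (Word [Vertex v]))) ` gis_words G"
proof -
  have "graph_inverse_semigroup G = gis_class G ` gis_words G"
    by (auto simp: graph_inverse_semigroup_def gis_class_def quotient_def)
  moreover have "gis_mult G (gis_mult G (gis_vertex G v) (gis_class G w)) (gis_vertex G v) =
      gis_class G (word_mult (word_mult (Word [Vertex v]) w) (Word [Vertex v]))"
    if "w \<in> gis_words G" for w
    using that vertex_word[OF assms]
    by (simp add: gis_vertex_def gis_mult_class word_mult_closed del: Word_in_gis_words)
  ultimately show ?thesis
    unfolding local_submonoid_def Setcompr_eq_image by (auto simp: image_image cong: image_cong)
qed

lemma zero_in_local_submonoid: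
  assumes "v \<in> verts G"
  shows "gis_zero G \<in> local_submonoid G v"
  unfolding local_submonoid_eq[OF assms] gis_zero_def by (rule image_eqI[of _ _ Zero]) auto

lemma vertex_in_local_submonoid:
  assumes "v \<in> verts G"
  shows "gis_vertex G v \<in> local_submonoid G v"
proof -
  have vw: "Word [Vertex v] \<in> gis_words G" using assms by (rule vertex_word)
  have "gis_mult G (gis_mult G (gis_vertex G v) (gis_vertex G v)) (gis_vertex G v) = gis_vertex G v"
    using gis_vertex_idem[OF assms] by simp
  moreover have "gis_vertex G v \<in> graph_inverse_semigroup G"
    using vw unfolding gis_vertex_def gis_class_def graph_inverse_semigroup_def by (rule quotientI)
  ultimately show ?thesis unfolding local_submonoid_def by force
qed

lemma local_submonoid_sink:
  assumes sink: "is_sink G v"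
  shows "local_submonoid G v \<subseteq> {gis_zero G, gis_vertex G v}"
proof -
  have v: "v \<in> verts G" using sink by (simp add: is_sink_def)
  have "gis_class G (word_mult (word_mult (Word [Vertex v]) w) (Word [Vertex v]))
      \<in> {gis_zero G, gis_vertex G v}" if w: "w \<in> gis_words G" for w
  proof (cases w)
    case Zero
    then show ?thesis by (simp add: gis_zero_def)
  next
    case (Word l)
    then have "set l \<subseteq> gis_gens G" using w by simp
    from sink_corner_word[OF sink this] show ?thesis
      using Word equiv_class_eq[OF equiv_gis_cong]
      by (auto simp: gis_zero_def gis_vertex_def gis_class_def)
  qed
  then show ?thesis unfolding local_submonoid_eq[OF v] by blast
qed

lemma local_submonoid_nontrivial:
  assumes e: "e \<in> arcs G"
  shows "local_submonoid G (tail G e) \<noteq> {gis_zero G, gis_vertex G (tail G e)}"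
proof
  let ?v = "tail G e"
  let ?w = "word_mult (word_mult (Word [Vertex ?v]) (Word [Edge e, Ghost e])) (Word [Vertex ?v])"
  assume triv: "local_submonoid G ?v = {gis_zero G, gis_vertex G ?v}"
  have v: "?v \<in> verts G" using e by simp
  have "Word [Edge e, Ghost e] \<in> gis_words G" using e by (simp add: gis_gens_def)
  then have "gis_class G ?w \<in> {gis_zero G, gis_vertex G ?v}"
    unfolding triv[symmetric] local_submonoid_eq[OF v] by blast
  moreover have "?w \<in> gis_words G" using e by (simp add: gis_gens_def)
  ultimately have "(?w, Zero) \<in> gis_cong G \<or> (?w, Word [Vertex ?v]) \<in> gis_cong G"
    using gis_class_eq_iff[OF _ Zero_in_gis_words] gis_class_eq_iff[OF _ vertex_word[OF v]]
    unfolding gis_zero_def gis_vertex_def by (metis insertE singletonD)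
  then have "word_act G ?w = word_act G Zero \<or> word_act G ?w = word_act G (Word [Vertex ?v])"
    by (auto dest!: gis_cong_act)
  \<comment> \<open>The ghost edge removes \<open>e\<close> from the path \<open>e\<close>, and the edge puts it back.\<close>
  moreover have "word_act G ?w ([e], head G e) \<noteq> word_act G Zero ([e], head G e)" by simp
  \<comment> \<open>The vertex fixes its empty path, which has no edge for the ghost edge to remove.\<close>
  moreover have "word_act G ?w ([], ?v) \<noteq> word_act G (Word [Vertex ?v]) ([], ?v)" by simp
  ultimately show False by metis
qed

end

theorem theorem4:
  fixes G :: "('a, 'b) pre_digraph" and v :: 'a
  assumes "wf_digraph G"
    and "verts G \<noteq> {}"
    and "v \<in> verts G"
  shows "local_submonoid G v = {gis_zero G, gis_vertex G v} \<longleftrightarrow> is_sink G v"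
proof -
  interpret wf_digraph G by fact
  show ?thesis
  proof
    assume triv: "local_submonoid G v = {gis_zero G, gis_vertex G v}"
    have "tail G e \<noteq> v" if "e \<in> arcs G" for e
      using local_submonoid_nontrivial[OF that] triv by auto
    then show "is_sink G v" using assms(3) unfolding is_sink_def out_arcs_def by blast
  next
    assume "is_sink G v"
    then show "local_submonoid G v = {gis_zero G, gis_vertex G v}"
      using local_submonoid_sink zero_in_local_submonoid vertex_in_local_submonoid assms(3) by blast
  qed
qed

end
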